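(* The sequence $\{\xi^k\}$ generated by the rank-two relaxed parallel splitting version of the augmented Lagrangian method (defined in the context, with $\beta>0$ and step size $\alpha\in(0,2)$) for the problem $\min\{\sum_{i=1}^p\theta_i(x_i) \mid \sum_{i=1}^pA_ix_i=b,\ x_i\in\mathcal{X}_i,\ i=1,\dots,p\}$ converges to some $\xi^\infty\in\Xi^*$.
   Context: Problem and standing assumptions: $p\ge 2$; for $i=1,\dots,p$, $\theta_i:\mathbb{R}^{n_i}\to\mathbb{R}$ is a closed, proper, convex (not necessarily smooth) function, $\mathcal{X}_i\subseteq\mathbb{R}^{n_i}$ is a closed convex set, $A_i\in\mathbb{R}^{m\times n_i}$ has full column rank, and $b\in\mathbb{R}^m$. The solution set of $\min\{\sum_{i=1}^p\theta_i(x_i) \mid \sum_{i=1}^pA_ix_i=b,\ x_i\in\mathcal{X}_i,\ i=1,\dots,p\}$ is assumed to be nonempty. Notation: $x=(x_1;\dots;x_p)$, $w=(x_1;\dots;x_p;\lambda)$ with $\lambda\in\mathbb{R}^m$, $\theta(x)=\sum_{i=1}^p\theta_i(x_i)$, $\Omega=\mathcal{X}_1\times\cdots\times\mathcal{X}_p\times\mathbb{R}^m$, and $F(w)=(-A_1^T\lambda;\dots;-A_p^T\lambda;\sum_{i=1}^pA_ix_i-b)$. The Lagrangian is $L(x_1,\dots,x_p,\lambda)=\sum_{i=1}^p\theta_i(x_i)-\lambda^T(\sum_{i=1}^pA_ix_i-b)$. $\Omega^*$ is the set of all $w^*=(x_1^*;\dots;x_p^*;\lambda^* )\in\Omega$ such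 that $\theta(x)-\theta(x^* )+(w-w^* )^TF(w^* )\ge 0$ for all $w\in\Omega$ (this is the set of saddle points of $L$ over $\Omega$). Let $P=\mathrm{diag}(A_1,\dots,A_p,I_m)$ (block diagonal) and $\xi=Pw=(A_1x_1;\dots;A_px_p;\lambda)$, and let $\Xi^*=\{Pw^* \mid w^*\in\Omega^*\}$. Matrices ($(p+1)\times(p+1)$ blocks of size $m\times m$): $\mathcal{D}=\mathrm{diag}(\beta I_m,\dots,\beta I_m,\frac1\beta I_m)$ (with $p$ copies of $\beta I_m$); $\mathcal{Q}$ has diagonal blocks $\beta I_m$ in positions $(i,i)$, $i\le p$, block $I_m$ in positions $(i,p+1)$, $i\le p$, block $-I_m$ in positions $(p+1,i)$, $i\le p$, block $\frac1\beta I_m$ in position $(p+1,p+1)$, and zero blocks elsewhere; $\mathcal{M}=\mathcal{Q}^{-T}\mathcal{D}$. Algorithm (rank-two relaxed parallel splitting version of the augmented Lagrangian method), with the notation $\xi^k=(A_1x_1^k;\dots;A_px_p^k;\lambda^k)$ and $\tilde\xi^k=(A_1\tilde x_1^k;\dots;A_p\tilde x_p^k;\tilde\lambda^k)$: with given $\xi^k$, compute for $i=1,\dots,p$ (in parallel) $$\tilde x_i^k\in\arg\min\Big\{L(x_1^k,\dots,x_{i-1}^k,x_i,x_{i+1}^k,\dots,x_p^k,\lambda^k)+\tfrac{\beta}{2}\|A_ix_i-A_ix_i^k\|^2 \;\Big|\; x_i\in\mathcal{X}_i\Big\},$$ $$\tilde\lambda^k=\lambda^k-\beta\Big(\sum_{i=1}^pA_ix_i^k-b\Big),$$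 and then generate the new iterate by $\xi^{k+1}=\xi^k-\alpha\mathcal{M}(\xi^k-\tilde\xi^k)$ with $\alpha\in(0,2)$.
   Formalization: The set Ω* of saddle points is assumed nonempty in addition to the solution set, since without a constraint qualification Ω* can be empty and then no limit in Ξ* exists. *)

theory Defs
  imports "HOL-Analysis.Analysis"
begin

(*
  The p blocks are indexed by a finite type 'p, and R^m is real^'m.  Since the block
  dimensions n_i differ, R^(n_i) is the coordinate subspace of an ambient real^'n spanned by
  a set N i of n_i coordinates; 'n has to be at least as large as the largest n_i only.
  An m x n_i matrix is a matrix over the ambient space whose columns outside N i vanish, so
  that it has full column rank iff its rank is card (N i).
*)

definition coord_space :: "'n set \<Rightarrow> (real^'n::finite) set" where
  "coord_space N = {v. \<forall>j. j \<notin> N \<longrightarrow> v $ j = 0}"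

definition coord_mats :: "'n set \<Rightarrow> (real^'n::finite^'m::finite) set" where
  "coord_mats N = {A. \<forall>j. j \<notin> N \<longrightarrow> column j A = 0}"

definition full_column_rank :: "'n set \<Rightarrow> real^'n::finite^'m::finite \<Rightarrow> bool" where
  "full_column_rank N A \<longleftrightarrow> rank A = card N"

(* For a real-valued function properness is automatic; closedness is that of the epigraph. *)
definition closed_convex_fun :: "'a::euclidean_space set \<Rightarrow> ('a \<Rightarrow> real) \<Rightarrow> bool" where
  "closed_convex_fun S f \<longleftrightarrow> convex_on S f \<and> closed (epigraph S f)"

definition objective :: "('p::finite \<Rightarrow> real^'n::finite \<Rightarrow> real) \<Rightarrow> real^'n^'p \<Rightarrow> real" where
  "objective \<theta> x = (\<Sum>i\<in>UNIV. \<theta> i (x $ i))"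

definition residual ::
    "('p::finite \<Rightarrow> real^'n::finite^'m::finite) \<Rightarrow> real^'m \<Rightarrow> real^'n^'p \<Rightarrow> real^'m" where
  "residual A b x = (\<Sum>i\<in>UNIV. A i *v (x $ i)) - b"

definition solution_set ::
    "('p::finite \<Rightarrow> real^'n::finite \<Rightarrow> real) \<Rightarrow> ('p \<Rightarrow> (real^'n) set) \<Rightarrow>
     ('p \<Rightarrow> real^'n^'m::finite) \<Rightarrow> real^'m \<Rightarrow> (real^'n^'p) set" where
  "solution_set \<theta> X A b =
     {x. is_arg_min (objective \<theta>) (\<lambda>x. (\<forall>i. x $ i \<in> X i) \<and> (\<Sum>i\<in>UNIV. A i *v (x $ i)) = b) x}"

definition Lagrangian ::
    "('p::finite \<Rightarrow> real^'n::finite \<Rightarrow> real) \<Rightarrow> ('p \<Rightarrow> real^'n^'m::finite) \<Rightarrow> real^'m \<Rightarrow>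
     real^'n^'p \<Rightarrow> real^'m \<Rightarrow> real" where
  "Lagrangian \<theta> A b x l = objective \<theta> x - l \<bullet> residual A b x"

(* w = (x_1; ...; x_p; lambda) is the pair (x, lambda). *)

definition Omega :: "('p::finite \<Rightarrow> (real^'n::finite) set) \<Rightarrow> ((real^'n^'p) \<times> (real^'m::finite)) set" where
  "Omega X = {x. \<forall>i. x $ i \<in> X i} \<times> UNIV"

definition VI_map ::
    "('p::finite \<Rightarrow> real^'n::finite^'m::finite) \<Rightarrow> real^'m \<Rightarrow>
     (real^'n^'p) \<times> (real^'m) \<Rightarrow> (real^'n^'p) \<times> (real^'m)" where
  "VI_map A b w = ((\<chi> i. - (transpose (A i) *v snd w)), residual A b (fst w))"

(*
  A nonempty solution set does not make Omega_star nonempty when no constraint qualification is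
  assumed, so the convergence theorem assumes both.  Example with p = 2 and empty Omega_star:
  theta_1(s,t) = s on the disc s^2 + (t-1)^2 <= 1, A_1 = I_2, theta_2 = 0 on R, A_2 = (1,0)^T, b = 0.
*)
definition Omega_star ::
    "('p::finite \<Rightarrow> real^'n::finite \<Rightarrow> real) \<Rightarrow> ('p \<Rightarrow> (real^'n) set) \<Rightarrow>
     ('p \<Rightarrow> real^'n^'m::finite) \<Rightarrow> real^'m \<Rightarrow> ((real^'n^'p) \<times> (real^'m)) set" where
  "Omega_star \<theta> X A b =
     {w \<in> Omega X. \<forall>v\<in>Omega X.
        objective \<theta> (fst v) - objective \<theta> (fst w) + (v - w) \<bullet> VI_map A b w \<ge> 0}"

(*
  The (p+1) blocks of size m are indexed by 'p option: Some i is block i, None is the last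
  block (the multiplier).  A scalar coordinate is a pair (block, row in the block).
*)

definition xblock :: "real^('p::finite option \<times> 'm::finite) \<Rightarrow> 'p \<Rightarrow> real^'m" where
  "xblock \<xi> i = (\<chi> r. \<xi> $ (Some i, r))"

definition lblock :: "real^('p::finite option \<times> 'm::finite) \<Rightarrow> real^'m" where
  "lblock \<xi> = (\<chi> r. \<xi> $ (None, r))"

(* The product of P = diag(A_1, ..., A_p, I_m) with w = (x, lambda). *)
definition P_map ::
    "('p::finite \<Rightarrow> real^'n::finite^'m::finite) \<Rightarrow> (real^'n^'p) \<times> (real^'m) \<Rightarrow>
     real^('p option \<times> 'm)" where
  "P_map A w = (\<chi> q. case q of (Some i, r) \<Rightarrow> (A i *v (fst w $ i)) $ r | (None, r) \<Rightarrow> snd w $ r)"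

definition Xi_star ::
    "('p::finite \<Rightarrow> real^'n::finite \<Rightarrow> real) \<Rightarrow> ('p \<Rightarrow> (real^'n) set) \<Rightarrow>
     ('p \<Rightarrow> real^'n^'m::finite) \<Rightarrow> real^'m \<Rightarrow> (real^('p option \<times> 'm)) set" where
  "Xi_star \<theta> X A b = P_map A ` Omega_star \<theta> X A b"

definition block_matrix ::
    "('p::finite option \<Rightarrow> 'p option \<Rightarrow> real^'m::finite^'m) \<Rightarrow>
     real^('p option \<times> 'm)^('p option \<times> 'm)" where
  "block_matrix B = (\<chi> q s. B (fst q) (fst s) $ snd q $ snd s)"

definition D_mat :: "real \<Rightarrow> real^('p::finite option \<times> 'm::finite)^('p option \<times> 'm)" where
  "D_mat \<beta> = block_matrix (\<lambda>s t. case (s, t) of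
      (Some i, Some j) \<Rightarrow> if i = j then mat \<beta> else 0
    | (None, None) \<Rightarrow> mat (1 / \<beta>)
    | _ \<Rightarrow> 0)"

definition Q_mat :: "real \<Rightarrow> real^('p::finite option \<times> 'm::finite)^('p option \<times> 'm)" where
  "Q_mat \<beta> = block_matrix (\<lambda>s t. case (s, t) of
      (Some i, Some j) \<Rightarrow> if i = j then mat \<beta> else 0
    | (Some i, None) \<Rightarrow> mat 1
    | (None, Some j) \<Rightarrow> - mat 1
    | (None, None) \<Rightarrow> mat (1 / \<beta>))"

definition M_mat :: "real \<Rightarrow> real^('p::finite option \<times> 'm::finite)^('p option \<times> 'm)" where
  "M_mat \<beta> = matrix_inv (transpose (Q_mat \<beta>)) ** D_mat \<beta>"

(*
  The method iterates on xi^k, whose blocks are written A_j x_j^k.  The correction step does not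
  keep block j in the range of A_j, so xi^k is treated as a free vector: only its blocks enter the
  subproblem.  The objective of the i-th subproblem is therefore the Lagrangian without its
  constant sum_{j ~= i} theta_j (x_j^k), plus the proximal term.  The lemma below shows that it is
  the literal one up to this constant whenever the blocks are of the form A_j x_j.
*)
definition sub_objective ::
    "('p::finite \<Rightarrow> real^'n::finite \<Rightarrow> real) \<Rightarrow> ('p \<Rightarrow> real^'n^'m::finite) \<Rightarrow> real^'m \<Rightarrow> real \<Rightarrow>
     real^('p option \<times> 'm) \<Rightarrow> 'p \<Rightarrow> real^'n \<Rightarrow> real" where
  "sub_objective \<theta> A b \<beta> \<xi> i y =
     \<theta> i y - lblock \<xi> \<bullet> (A i *v y + (\<Sum>j\<in>UNIV - {i}. xblock \<xi> j) - b)
     + \<beta> / 2 * (norm (A i *v y - xblock \<xi> i))\<^sup>2"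

lemma sub_objective_Lagrangian:
  fixes x :: "real^'n::finite^'p::finite" and A :: "'p \<Rightarrow> real^'n^'m::finite"
  assumes "\<xi> = P_map A (x, l)"
  shows "Lagrangian \<theta> A b (\<chi> j. if j = i then y else x $ j) l
           + \<beta> / 2 * (norm (A i *v y - A i *v (x $ i)))\<^sup>2
         = (\<Sum>j\<in>UNIV - {i}. \<theta> j (x $ j)) + sub_objective \<theta> A b \<beta> \<xi> i y"
proof -
  have xb: "xblock \<xi> j = A j *v (x $ j)" for j
    by (simp add: assms P_map_def xblock_def vec_eq_iff)
  have lb: "lblock \<xi> = l"
    by (simp add: assms P_map_def lblock_def vec_eq_iff)
  show ?thesis
    by (simp add: Lagrangian_def objective_def residual_def sub_objective_def xb lb
        sum.remove[of UNIV i])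
qed

definition predictor ::
    "('p::finite \<Rightarrow> real^'n::finite \<Rightarrow> real) \<Rightarrow> ('p \<Rightarrow> (real^'n) set) \<Rightarrow>
     ('p \<Rightarrow> real^'n^'m::finite) \<Rightarrow> real^'m \<Rightarrow> real \<Rightarrow>
     real^('p option \<times> 'm) \<Rightarrow> (real^'n^'p) \<times> (real^'m) \<Rightarrow> bool" where
  "predictor \<theta> X A b \<beta> \<xi> w \<longleftrightarrow>
     (\<forall>i. is_arg_min (sub_objective \<theta> A b \<beta> \<xi> i) (\<lambda>y. y \<in> X i) (fst w $ i)) \<and>
     snd w = lblock \<xi> - \<beta> *\<^sub>R ((\<Sum>i\<in>UNIV. xblock \<xi> i) - b)"

definition generated_sequence ::
    "('p::finite \<Rightarrow> real^'n::finite \<Rightarrow> real) \<Rightarrow> ('p \<Rightarrow> (real^'n) set) \<Rightarrow>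
     ('p \<Rightarrow> real^'n^'m::finite) \<Rightarrow> real^'m \<Rightarrow> real \<Rightarrow> real \<Rightarrow>
     (nat \<Rightarrow> real^('p option \<times> 'm)) \<Rightarrow> bool" where
  "generated_sequence \<theta> X A b \<beta> \<alpha> \<xi> \<longleftrightarrow>
     (\<forall>k. \<exists>w. predictor \<theta> X A b \<beta> (\<xi> k) w \<and>
              \<xi> (Suc k) = \<xi> k - \<alpha> *\<^sub>R (M_mat \<beta> *v (\<xi> k - P_map A w)))"

end

theory Submission
  imports Defs
begin

text \<open>
  Write \<open>d = \<xi> - \<xi>'\<close> for the difference between an iterate \<open>\<xi>\<close> and its prediction \<open>\<xi>'\<close>. The
  optimality conditions of the subproblems say that the prediction solves the variational
  inequality that defines \<open>\<Omega>\<^sup>*\<close> up to the error \<open>Q d\<close>. Testing it at a solution \<open>\<zeta>\<close>, and using that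
  the linear part of \<open>F\<close> is skew, gives \<open>(\<xi>' - \<zeta>) \<bullet> Q d \<ge> 0\<close> (\<open>predictor_Fejer_inequality\<close>).
  The symmetric part of \<open>Q\<close> is the positive definite matrix \<open>D\<close>, hence
  \<open>(\<xi> - \<zeta>) \<bullet> Q d \<ge> d \<bullet> D d\<close>.

  In the coordinates \<open>g = M\<^sup>-\<^sup>1 \<xi> = D\<^sup>-\<^sup>1 Q\<^sup>T \<xi>\<close> the correction is the plain step
  \<open>g - \<alpha> d\<close>, and \<open>(\<xi> - \<zeta>) \<bullet> Q d\<close> is the \<open>D\<close>-inner product of \<open>M\<^sup>-\<^sup>1 (\<xi> - \<zeta>)\<close> with \<open>d\<close>. Expanding
  the square, the squared \<open>D\<close>-distance of \<open>g\<close> to \<open>M\<^sup>-\<^sup>1 \<zeta>\<close> drops in each step by at least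
  \<open>\<alpha> (2 - \<alpha>) (d \<bullet> D d)\<close>. So the iterates are bounded and \<open>d\<close> tends to 0. A cluster point that
  lies in the solution set is then the limit of the whole sequence, because the distance to it
  decreases along the sequence (\<open>prediction_correction_converges\<close>).

  It remains to see that cluster points are solutions (\<open>Xi_star_if_predictor_limit\<close>). Full column
  rank turns convergence of the blocks \<open>A\<^sub>i x\<^sub>i\<close> into convergence of the \<open>x\<^sub>i\<close>, and closedness of the
  epigraphs lets the optimality conditions of the subproblems pass to the limit, where the proximal
  terms vanish.
\<close>

section \<open>Positive definite matrices\<close>

lemma matrix_inv_inverse:
  fixes B :: "real^'q::finite^'q"
  assumes "invertible B"
  shows "B ** matrix_inv B = mat 1" and "matrix_inv B ** B = mat 1"
  using someI_ex[OF assms[unfolded invertible_def]] unfolding matrix_inv_def by auto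

lemma positive_definite_invertible:
  fixes B :: "real^'q::finite^'q"
  assumes "\<And>x. x \<noteq> 0 \<Longrightarrow> 0 < x \<bullet> (B *v x)"
  shows "invertible B"
proof -
  have "inj ((*v) B)"
  proof (rule injI)
    fix x y assume "B *v x = B *v y"
    then have "B *v (x - y) = 0" by (simp add: matrix_vector_mult_diff_distrib)
    then show "x = y" using assms[of "x - y"] by fastforce
  qed
  then show ?thesis
    unfolding invertible_left_inverse matrix_left_invertible_injective .
qed

text \<open>The constant is the minimum of the quadratic form on the unit sphere.\<close>

lemma positive_definite_coercive:
  fixes B :: "real^'q::finite^'q"
  assumes pos: "\<And>x. x \<noteq> 0 \<Longrightarrow> 0 < x \<bullet> (B *v x)"
  shows "\<exists>c>0. \<forall>x. c * (norm x)\<^sup>2 \<le> x \<bullet> (B *v x)"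
proof -
  have "\<exists>u\<in>sphere 0 1. \<forall>y\<in>sphere 0 1. u \<bullet> (B *v u) \<le> y \<bullet> (B *v y)"
  proof (rule continuous_attains_inf)
    show "compact (sphere (0::real^'q) 1)" by simp
    show "sphere (0::real^'q) 1 \<noteq> {}" by simp
    show "continuous_on (sphere 0 1) (\<lambda>x. x \<bullet> (B *v x))"
      by (intro continuous_intros matrix_vector_mult_linear_continuous_on)
  qed
  then obtain u where u: "norm u = 1"
    and min: "\<And>y. norm y = 1 \<Longrightarrow> u \<bullet> (B *v u) \<le> y \<bullet> (B *v y)"
    by auto
  have "u \<bullet> (B *v u) * (norm x)\<^sup>2 \<le> x \<bullet> (B *v x)" for x
  proof (cases "x = 0")
    case False
    define y where "y = (1 / norm x) *\<^sub>R x"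
    have x: "x = norm x *\<^sub>R y" and y: "norm y = 1"
      using False by (auto simp: y_def)
    have "x \<bullet> (B *v x) = (norm x)\<^sup>2 * (y \<bullet> (B *v y))"
      by (subst (1 2) x) (simp add: matrix_vector_mult_scaleR power2_eq_square)
    with mult_left_mono[OF min[OF y], of "(norm x)\<^sup>2"] show ?thesis
      by (simp add: mult.commute)
  qed simp
  moreover have "0 < u \<bullet> (B *v u)" using u by (intro pos) auto
  ultimately show ?thesis by blast
qed

lemma symmetric_matrix_inner:
  fixes D :: "real^'q::finite^'q"
  assumes "transpose D = D"
  shows "(D *v x) \<bullet> y = x \<bullet> (D *v y)"
  by (metis assms dot_lmul_matrix transpose_matrix_vector)

section \<open>Convergence of prediction-correction iterations\<close>

text \<open>
  This is a Fejer monotonicity argument in the norm of \<open>H = Q D\<^sup>-\<^sup>1 Q\<^sup>T\<close>, for which \<open>H M = Q\<close> and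
  \<open>M\<^sup>T H M = D\<close>. The squared norm is the energy \<open>E\<close> of the proof, written as \<open>G x \<bullet> D (G x)\<close>
  with \<open>G = M\<^sup>-\<^sup>1\<close>, since \<open>G\<close> turns the correction into a step along \<open>\<xi> - \<xi>'\<close> itself.
\<close>

lemma prediction_correction_converges:
  fixes D Q :: "real^'q::finite^'q" and \<xi> \<xi>' :: "nat \<Rightarrow> real^'q"
  assumes sym: "transpose D = D"
    and pos: "\<And>x. x \<noteq> 0 \<Longrightarrow> 0 < x \<bullet> (D *v x)"
    and QD: "\<And>x. x \<bullet> (Q *v x) = x \<bullet> (D *v x)"
    and \<alpha>: "0 < \<alpha>" "\<alpha> < 2"
    and step: "\<And>k. \<xi> (Suc k) = \<xi> k - \<alpha> *\<^sub>R ((matrix_inv (transpose Q) ** D) *v (\<xi> k - \<xi>' k))"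
    and vi: "\<And>k z. z \<in> Z \<Longrightarrow> 0 \<le> (\<xi>' k - z) \<bullet> (Q *v (\<xi> k - \<xi>' k))"
    and ne: "Z \<noteq> {}"
    and clos: "\<And>r \<zeta>. strict_mono (r :: nat \<Rightarrow> nat) \<Longrightarrow> (\<xi> \<circ> r) \<longlonglongrightarrow> \<zeta> \<Longrightarrow> (\<xi>' \<circ> r) \<longlonglongrightarrow> \<zeta> \<Longrightarrow> \<zeta> \<in> Z"
  shows "\<exists>\<zeta>\<in>Z. \<xi> \<longlonglongrightarrow> \<zeta>"
proof -
  have invD: "invertible D" by (rule positive_definite_invertible[OF pos])
  have QT: "x \<bullet> (transpose Q *v x) = x \<bullet> (D *v x)" for x
    by (metis QD dot_lmul_matrix inner_commute transpose_matrix_vector)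
  have invQ: "invertible (transpose Q)"
    by (rule positive_definite_invertible) (metis QT pos)
  define M where "M = matrix_inv (transpose Q) ** D"
  \<comment> \<open>\<open>G\<close> is the inverse of \<open>M\<close>; \<open>D G = Q\<^sup>T\<close> links the energy to the hypothesis on \<open>Q\<close>\<close>
  define G where "G = matrix_inv D ** transpose Q"
  have DG: "D *v (G *v x) = transpose Q *v x" for x
    by (simp only: G_def matrix_vector_mul_assoc matrix_mul_assoc matrix_inv_inverse[OF invD]
        matrix_mul_lid)
  have "G ** M = matrix_inv D ** (transpose Q ** matrix_inv (transpose Q)) ** D"
    by (simp only: G_def M_def matrix_mul_assoc)
  also have "\<dots> = mat 1"
    by (simp only: matrix_inv_inverse[OF invD] matrix_inv_inverse[OF invQ] matrix_mul_rid)
  finally have GM: "G *v (M *v x) = x" for x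
    by (simp only: matrix_vector_mul_assoc matrix_vector_mul_lid)
  define E where "E x = (G *v x) \<bullet> (D *v (G *v x))" for x
  define d where "d k = \<xi> k - \<xi>' k" for k
  have Epos: "0 < x \<bullet> ((transpose G ** D ** G) *v x)" if "x \<noteq> 0" for x
  proof -
    have "G *v x \<noteq> 0"
      using QT[of x] pos[OF that] by (metis DG inner_zero_right less_irrefl matrix_vector_mult_0_right)
    from pos[OF this] show ?thesis
      by (metis dot_lmul_matrix inner_commute matrix_vector_mul_assoc transpose_matrix_vector)
  qed
  obtain c where c: "c > 0" "\<And>x. c * (norm x)\<^sup>2 \<le> E x"
    using positive_definite_coercive[OF Epos] unfolding E_def
    by (metis dot_lmul_matrix inner_commute matrix_vector_mul_assoc transpose_matrix_vector)
  obtain e where e: "e > 0" "\<And>x. e * (norm x)\<^sup>2 \<le> x \<bullet> (D *v x)"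
    using positive_definite_coercive[OF pos] by blast
  have dD: "0 \<le> x \<bullet> (D *v x)" for x
    using e(2)[of x] e(1) by (smt (verit) mult_nonneg_nonneg zero_le_power2)

  have descent: "E (\<xi> (Suc k) - z) \<le> E (\<xi> k - z) - \<alpha> * (2 - \<alpha>) * (d k \<bullet> (D *v d k))"
    if z: "z \<in> Z" for k z
  proof -
    define g where "g = G *v (\<xi> k - z)"
    have "\<xi> (Suc k) - z = (\<xi> k - z) - \<alpha> *\<^sub>R (M *v d k)"
      by (simp add: step M_def d_def)
    then have "G *v (\<xi> (Suc k) - z) = g - \<alpha> *\<^sub>R d k"
      by (simp add: g_def matrix_vector_mult_diff_distrib matrix_vector_mult_scaleR GM)
    then have "E (\<xi> (Suc k) - z) = (g - \<alpha> *\<^sub>R d k) \<bullet> (D *v (g - \<alpha> *\<^sub>R d k))"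
      by (simp add: E_def)
    also have "\<dots> = g \<bullet> (D *v g) - 2 * \<alpha> * (g \<bullet> (D *v d k)) + \<alpha>\<^sup>2 * (d k \<bullet> (D *v d k))"
      using symmetric_matrix_inner[OF sym, of "d k" g]
      by (simp add: matrix_vector_mult_diff_distrib matrix_vector_mult_scaleR inner_diff_left
          inner_diff_right power2_eq_square inner_commute algebra_simps)
    finally have E1: "E (\<xi> (Suc k) - z) =
        E (\<xi> k - z) - 2 * \<alpha> * (g \<bullet> (D *v d k)) + \<alpha>\<^sup>2 * (d k \<bullet> (D *v d k))"
      by (simp add: E_def g_def)
    have "g \<bullet> (D *v d k) = (transpose Q *v (\<xi> k - z)) \<bullet> d k"
      by (simp only: g_def DG symmetric_matrix_inner[OF sym, symmetric])
    also have "\<dots> = (\<xi> k - z) \<bullet> (Q *v d k)"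
      by (simp add: dot_lmul_matrix)
    also have "\<dots> = (\<xi>' k - z) \<bullet> (Q *v d k) + d k \<bullet> (Q *v d k)"
      by (simp add: d_def flip: inner_add_left)
    also have "\<dots> \<ge> d k \<bullet> (D *v d k)"
      using vi[OF z, of k] by (simp add: QD d_def)
    finally have "2 * \<alpha> * (d k \<bullet> (D *v d k)) \<le> 2 * \<alpha> * (g \<bullet> (D *v d k))"
      using \<alpha> by simp
    then show ?thesis
      unfolding E1 by (simp add: algebra_simps power2_eq_square)
  qed
  have E0: "0 \<le> E x" for x by (simp add: E_def dD)
  have dec: "decseq (\<lambda>k. E (\<xi> k - z))" if "z \<in> Z" for z
  proof (rule decseq_SucI)
    fix k
    have "0 \<le> \<alpha> * (2 - \<alpha>) * (d k \<bullet> (D *v d k))"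
      using \<alpha> dD by simp
    with descent[OF that, of k] show "E (\<xi> (Suc k) - z) \<le> E (\<xi> k - z)" by linarith
  qed
  have conv: "convergent (\<lambda>k. E (\<xi> k - z))" if "z \<in> Z" for z
    by (rule convergentI) (rule LIMSEQ_decseq_INF[OF bdd_belowI2 dec[OF that]], rule E0)

  obtain z where z: "z \<in> Z" using ne by blast
  have d0: "d \<longlonglongrightarrow> 0"
  proof -
    obtain L where L: "(\<lambda>k. E (\<xi> k - z)) \<longlonglongrightarrow> L"
      using conv[OF z] by (auto simp: convergent_def)
    have "(\<lambda>k. (E (\<xi> k - z) - E (\<xi> (Suc k) - z)) / (\<alpha> * (2 - \<alpha>) * e)) \<longlonglongrightarrow>
        (L - L) / (\<alpha> * (2 - \<alpha>) * e)"
      using \<alpha> e(1) by (intro tendsto_intros L LIMSEQ_Suc[OF L]) auto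
    then have lim: "(\<lambda>k. (E (\<xi> k - z) - E (\<xi> (Suc k) - z)) / (\<alpha> * (2 - \<alpha>) * e)) \<longlonglongrightarrow> 0"
      by simp
    have "(norm (d k))\<^sup>2 \<le> (E (\<xi> k - z) - E (\<xi> (Suc k) - z)) / (\<alpha> * (2 - \<alpha>) * e)" for k
    proof -
      have "\<alpha> * (2 - \<alpha>) * (e * (norm (d k))\<^sup>2) \<le> \<alpha> * (2 - \<alpha>) * (d k \<bullet> (D *v d k))"
        using e(2) \<alpha> by (intro mult_left_mono) auto
      also have "\<dots> \<le> E (\<xi> k - z) - E (\<xi> (Suc k) - z)"
        using descent[OF z, of k] by linarith
      finally show ?thesis
        using \<alpha> e(1) by (simp add: pos_le_divide_eq mult_ac)
    qed
    then have "(\<lambda>k. (norm (d k))\<^sup>2) \<longlonglongrightarrow> 0"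
      by (intro tendsto_sandwich[OF _ _ tendsto_const lim]) auto
    then have "(\<lambda>k. sqrt ((norm (d k))\<^sup>2)) \<longlonglongrightarrow> sqrt 0"
      by (rule tendsto_real_sqrt)
    then show ?thesis by (simp add: tendsto_norm_zero_iff)
  qed
  have "bounded (range \<xi>)"
  proof -
    have "norm (\<xi> k - z) \<le> sqrt (E (\<xi> 0 - z) / c)" for k
    proof (rule real_le_rsqrt)
      have "c * (norm (\<xi> k - z))\<^sup>2 \<le> E (\<xi> 0 - z)"
        using c(2)[of "\<xi> k - z"] decseqD[OF dec[OF z], of 0 k] by simp
      then show "(norm (\<xi> k - z))\<^sup>2 \<le> E (\<xi> 0 - z) / c"
        using c(1) by (simp add: pos_le_divide_eq mult.commute)
    qed
    then show ?thesis
      by (intro boundedI[where B = "sqrt (E (\<xi> 0 - z) / c) + norm z"])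
        (smt (verit) imageE norm_triangle_sub)
  qed
  then obtain \<zeta> r where r: "strict_mono (r :: nat \<Rightarrow> nat)" and \<zeta>: "(\<xi> \<circ> r) \<longlonglongrightarrow> \<zeta>"
    using bounded_imp_convergent_subsequence by blast
  have "(\<lambda>k. (\<xi> \<circ> r) k - (d \<circ> r) k) \<longlonglongrightarrow> \<zeta> - 0"
    by (intro tendsto_diff \<zeta> LIMSEQ_subseq_LIMSEQ[OF d0 r])
  then have "(\<xi>' \<circ> r) \<longlonglongrightarrow> \<zeta>" by (simp add: d_def o_def)
  from clos[OF r \<zeta> this] have \<zeta>Z: "\<zeta> \<in> Z" .
  obtain L where L: "(\<lambda>k. E (\<xi> k - \<zeta>)) \<longlonglongrightarrow> L"
    using conv[OF \<zeta>Z] by (auto simp: convergent_def)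
  have "(\<lambda>k. (\<xi> \<circ> r) k - \<zeta>) \<longlonglongrightarrow> \<zeta> - \<zeta>" by (intro tendsto_intros \<zeta>)
  then have glim: "(\<lambda>k. G *v ((\<xi> \<circ> r) k - \<zeta>)) \<longlonglongrightarrow> G *v 0"
    by (intro bounded_linear.tendsto[OF matrix_vector_mul_bounded_linear]) simp
  have "(\<lambda>k. E ((\<xi> \<circ> r) k - \<zeta>)) \<longlonglongrightarrow> (G *v 0) \<bullet> (D *v (G *v 0))"
    unfolding E_def
    by (rule tendsto_inner[OF glim
          bounded_linear.tendsto[OF matrix_vector_mul_bounded_linear glim]])
  moreover have "(\<lambda>k. E ((\<xi> \<circ> r) k - \<zeta>)) \<longlonglongrightarrow> L"
    using LIMSEQ_subseq_LIMSEQ[OF L r] by (simp add: o_def)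
  ultimately have "L = 0" by (metis LIMSEQ_unique inner_zero_left matrix_vector_mult_0_right)
  with L have lim: "(\<lambda>k. E (\<xi> k - \<zeta>) / c) \<longlonglongrightarrow> 0"
    by (auto intro: tendsto_divide_zero)
  have "(norm (\<xi> k - \<zeta>))\<^sup>2 \<le> E (\<xi> k - \<zeta>) / c" for k
    using c by (simp add: pos_le_divide_eq mult.commute)
  then have "(\<lambda>k. (norm (\<xi> k - \<zeta>))\<^sup>2) \<longlonglongrightarrow> 0"
    by (intro tendsto_sandwich[OF _ _ tendsto_const lim]) auto
  then have "(\<lambda>k. sqrt ((norm (\<xi> k - \<zeta>))\<^sup>2)) \<longlonglongrightarrow> sqrt 0"
    by (rule tendsto_real_sqrt)
  then have "\<xi> \<longlonglongrightarrow> \<zeta>" by (simp add: tendsto_norm_zero_iff LIM_zero_iff)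
  with \<zeta>Z show ?thesis by blast
qed

section \<open>Block structure\<close>

lemma sum_blocks:
  fixes f :: "'p::finite option \<times> 'm::finite \<Rightarrow> real"
  shows "sum f UNIV = (\<Sum>i\<in>UNIV. \<Sum>r\<in>UNIV. f (Some i, r)) + (\<Sum>r\<in>UNIV. f (None, r))"
proof -
  have "sum f UNIV = (\<Sum>s\<in>UNIV. \<Sum>r\<in>UNIV. f (s, r))"
    by (simp add: sum.cartesian_product)
  also have "\<dots> = (\<Sum>s\<in>insert None (range Some). \<Sum>r\<in>UNIV. f (s, r))"
    by (simp only: UNIV_option_conv)
  finally show ?thesis by (simp add: sum.reindex)
qed

lemma inner_blocks:
  "x \<bullet> y = (\<Sum>i\<in>UNIV. xblock x i \<bullet> xblock y i) + lblock x \<bullet> lblock y"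
  by (simp add: inner_vec_def sum_blocks xblock_def lblock_def)

lemma vec_eq_blocksI:
  assumes "\<And>i. xblock x i = xblock y i" and "lblock x = lblock y"
  shows "x = y"
proof -
  have "x $ (s, r) = y $ (s, r)" for s r
    using assms by (cases s) (auto simp: xblock_def lblock_def vec_eq_iff)
  then show ?thesis by (auto simp: vec_eq_iff)
qed

lemma block_matrix_mult:
  "xblock (block_matrix B *v x) i =
     (\<Sum>j\<in>UNIV. B (Some i) (Some j) *v xblock x j) + B (Some i) None *v lblock x"
  "lblock (block_matrix B *v x) =
     (\<Sum>j\<in>UNIV. B None (Some j) *v xblock x j) + B None None *v lblock x"
  by (simp_all add: vec_eq_iff xblock_def lblock_def block_matrix_def matrix_vector_mult_def
      sum_blocks)

lemma mat_mult_vec: "mat c *v v = c *\<^sub>R (v :: real^'m::finite)"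
  by (simp add: vec_eq_iff matrix_vector_mult_def mat_def if_distrib if_distribR cong: if_cong)

lemma uminus_mat_mult_vec: "(- mat 1) *v v = - (v :: real^'m::finite)"
  by (simp add: vec_eq_iff matrix_vector_mult_def mat_def if_distrib if_distribR sum_negf cong: if_cong)

lemma D_mat_blocks:
  "xblock (D_mat \<beta> *v x) i = \<beta> *\<^sub>R xblock x i"
  "lblock (D_mat \<beta> *v x) = (1 / \<beta>) *\<^sub>R lblock x"
  by (simp_all add: D_mat_def block_matrix_mult mat_mult_vec if_distrib if_distribR cong: if_cong)

lemma Q_mat_blocks:
  "xblock (Q_mat \<beta> *v x) i = \<beta> *\<^sub>R xblock x i + lblock x"
  "lblock (Q_mat \<beta> *v x) = (1 / \<beta>) *\<^sub>R lblock x - (\<Sum>j\<in>UNIV. xblock x j)"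
  by (simp_all add: Q_mat_def block_matrix_mult mat_mult_vec uminus_mat_mult_vec sum_negf
      if_distrib if_distribR cong: if_cong)

lemma P_map_blocks:
  "xblock (P_map A w) i = A i *v (fst w $ i)"
  "lblock (P_map A w) = snd w"
  by (simp_all add: vec_eq_iff xblock_def lblock_def P_map_def)

lemma block_diff:
  "xblock (x - y) i = xblock x i - xblock y i" "lblock (x - y) = lblock x - lblock y"
  by (simp_all add: vec_eq_iff xblock_def lblock_def)

lemma tendsto_blocks:
  assumes "(f \<longlongrightarrow> x) F"
  shows "((\<lambda>k. xblock (f k) i) \<longlongrightarrow> xblock x i) F" and "((\<lambda>k. lblock (f k)) \<longlongrightarrow> lblock x) F"
  unfolding xblock_def lblock_def by (intro tendsto_vec_lambda tendsto_vec_nth assms)+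

lemma transpose_D_mat: "transpose (D_mat \<beta>) = D_mat \<beta>"
  by (auto simp: vec_eq_iff transpose_def D_mat_def block_matrix_def mat_def split: option.split)

lemma Q_mat_quadratic_form: "x \<bullet> (Q_mat \<beta> *v x) = x \<bullet> (D_mat \<beta> *v x)"
  by (simp add: inner_blocks Q_mat_blocks D_mat_blocks inner_add_right inner_diff_right sum.distrib
      inner_sum_right inner_commute)

lemma D_mat_positive_definite:
  assumes "\<beta> > 0" and "x \<noteq> 0"
  shows "0 < x \<bullet> (D_mat \<beta> *v x)"
proof -
  have eq: "x \<bullet> (D_mat \<beta> *v x) =
      \<beta> * (\<Sum>i\<in>UNIV. xblock x i \<bullet> xblock x i) + (1 / \<beta>) * (lblock x \<bullet> lblock x)"
    by (simp add: inner_blocks D_mat_blocks sum_distrib_left)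
  have nn: "0 \<le> (\<Sum>i\<in>UNIV. xblock x i \<bullet> xblock x i)" by (simp add: sum_nonneg)
  have "0 < (\<Sum>i\<in>UNIV. xblock x i \<bullet> xblock x i) + lblock x \<bullet> lblock x"
    using assms(2) inner_gt_zero_iff[of x] unfolding inner_blocks[of x x] by blast
  then consider "0 < (\<Sum>i\<in>UNIV. xblock x i \<bullet> xblock x i)" | "0 < lblock x \<bullet> lblock x"
    using nn by (metis add_0 nn order_less_le)
  then show ?thesis
  proof cases
    case 1
    then have "0 < \<beta> * (\<Sum>i\<in>UNIV. xblock x i \<bullet> xblock x i)" using assms(1) by simp
    moreover have "0 \<le> (1 / \<beta>) * (lblock x \<bullet> lblock x)" using assms(1) by simp
    ultimately show ?thesis unfolding eq by linarith
  next
    case 2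
    then have "0 < (1 / \<beta>) * (lblock x \<bullet> lblock x)" using assms(1) by simp
    moreover have "0 \<le> \<beta> * (\<Sum>i\<in>UNIV. xblock x i \<bullet> xblock x i)" using assms(1) nn by simp
    ultimately show ?thesis unfolding eq by linarith
  qed
qed

section \<open>Full column rank\<close>

text \<open>
  Columns outside \<open>N\<close> vanish, so the range of \<open>A\<close> is already the image of the coordinate subspace.
  Its dimension is that of the subspace, which forces the image of a basis to be independent.
  The inverse is wanted as a linear map because it carries convergence of \<open>A x\<close> back to \<open>x\<close>.
\<close>

lemma full_column_rank_left_inverse:
  fixes A :: "real^'n::finite^'m::finite"
  assumes "A \<in> coord_mats N" and "full_column_rank N A"
  obtains g where "linear g" and "\<And>x. x \<in> coord_space N \<Longrightarrow> g (A *v x) = x"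
proof -
  let ?V = "coord_space N :: (real^'n) set"
  have V: "subspace ?V" by (simp add: coord_space_def subspace_def)
  have "vec.dim {x :: real^'n. \<forall>i. i \<notin> N \<longrightarrow> x $ i = 0} = card N"
    by (rule dim_substandard_cart)
  then have dimV: "dim ?V = card N" by (simp only: dim_vec_eq coord_space_def)
  obtain B where B: "B \<subseteq> ?V" "independent B" "?V \<subseteq> span B" "card B = card N"
    using basis_exists[of ?V] dimV by metis
  have fin: "finite B" using B(2) by (rule independent_imp_finite)
  have range: "range ((*v) A) \<subseteq> span ((*v) A ` B)"
  proof clarify
    fix x :: "real^'n"
    define y :: "real^'n" where "y = (\<chi> j. if j \<in> N then x $ j else 0)"
    have "(x $ j) *s column j A = (y $ j) *s column j A" for j
      using assms(1) by (auto simp: y_def coord_mats_def)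
    then have "A *v x = A *v y" by (simp only: matrix_mult_sum)
    moreover have "y \<in> span B" using B(3) by (auto simp: y_def coord_space_def)
    ultimately show "A *v x \<in> span ((*v) A ` B)"
      by (auto simp: linear_span_image)
  qed
  have dimA: "card N = dim (range ((*v) A))"
    using assms(2) by (simp add: full_column_rank_def rank_dim_range)
  then have le: "card N \<le> card ((*v) A ` B)"
    using dim_le_card[OF range] fin by simp
  then have "inj_on ((*v) A) B"
    using B(4) fin by (metis card_image_le eq_card_imp_inj_on le_antisym)
  moreover have "independent ((*v) A ` B)"
    by (rule card_le_dim_spanning[OF _ range]) (use fin dimA B(4) card_image_le[OF fin, of "(*v) A"] in auto)
  ultimately have "inj_on ((*v) A) (span B)"
    by (intro linear_inj_on_span_independent_image) auto
  then have "inj_on ((*v) A) ?V" using B(3) by (rule inj_on_subset)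
  then obtain g where "linear g" "\<forall>x\<in>?V. g (A *v x) = x"
    using linear_exists_left_inverse_on[OF matrix_vector_mul_linear V] by blast
  then show thesis using that by blast
qed

section \<open>Optimality of the prediction\<close>

text \<open>
  Compare the minimizer with the points \<open>(1 - t) x + t y\<close> and let \<open>t\<close> tend to 0: convexity bounds
  the increase of \<open>f\<close> linearly in \<open>t\<close>, and the smooth terms contribute their derivative. The
  shift \<open>s\<close> absorbs the blocks that are held fixed.
\<close>

lemma proximal_minimizer_variational_inequality:
  fixes f :: "'a::real_vector \<Rightarrow> real" and B :: "'a \<Rightarrow> 'b::real_inner"
  assumes "convex_on C f" and B: "linear B"
    and min: "is_arg_min (\<lambda>y. f y - l \<bullet> (B y + s) + \<beta> / 2 * (norm (B y - a))\<^sup>2) (\<lambda>y. y \<in> C) x"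
    and y: "y \<in> C"
  shows "f x \<le> f y + (B y - B x) \<bullet> (\<beta> *\<^sub>R (B x - a) - l)"
proof -
  have x: "x \<in> C" using min by (simp add: is_arg_min_def)
  define h where "h = B y - B x"
  define S where "S = f y - f x + h \<bullet> (\<beta> *\<^sub>R (B x - a) - l)"
  have first: "0 \<le> S + t * (\<beta> / 2 * (norm h)\<^sup>2)" if t: "0 < t" "t < 1" for t
  proof -
    define u where "u = (1 - t) *\<^sub>R x + t *\<^sub>R y"
    have u: "u \<in> C" "f u \<le> (1 - t) * f x + t * f y"
      using assms(1) x y t by (auto simp: u_def convex_on_def convex_alt)
    have Bu: "B u = B x + t *\<^sub>R h"
      by (simp add: u_def h_def linear_add[OF B] linear_diff[OF B] linear_scale[OF B] algebra_simps)
    have sq: "(norm (B u - a))\<^sup>2 =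
        (norm (B x - a))\<^sup>2 + 2 * t * (h \<bullet> (B x - a)) + t\<^sup>2 * (norm h)\<^sup>2"
      unfolding power2_norm_eq_inner Bu
      by (simp add: inner_add_left inner_add_right inner_diff_left
          inner_diff_right inner_commute power2_eq_square algebra_simps)
    have "f x - l \<bullet> (B x + s) + \<beta> / 2 * (norm (B x - a))\<^sup>2
        \<le> f u - l \<bullet> (B u + s) + \<beta> / 2 * (norm (B u - a))\<^sup>2"
      using min u(1) by (auto simp: is_arg_min_def not_less)
    also have "\<dots> \<le> (1 - t) * f x + t * f y - l \<bullet> (B u + s) + \<beta> / 2 * (norm (B u - a))\<^sup>2"
      using u(2) by simp
    finally have "0 \<le> t * (S + t * (\<beta> / 2 * (norm h)\<^sup>2))"
      unfolding sq by (simp add: Bu S_def inner_add_right inner_diff_right inner_commute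
          power2_eq_square algebra_simps)
    then show ?thesis using t by (simp add: zero_le_mult_iff)
  qed
  have "((\<lambda>t. S + t * (\<beta> / 2 * (norm h)\<^sup>2)) \<longlongrightarrow> S + 0 * (\<beta> / 2 * (norm h)\<^sup>2)) (at_right 0)"
    by (intro tendsto_intros)
  moreover have "eventually (\<lambda>t. 0 \<le> S + t * (\<beta> / 2 * (norm h)\<^sup>2)) (at_right (0::real))"
    unfolding eventually_at_right_field using first by (intro exI[of _ 1]) auto
  ultimately have "0 \<le> S"
    using tendsto_lowerbound[of "\<lambda>t. S + t * (\<beta> / 2 * (norm h)\<^sup>2)" _ "at_right 0" 0] by auto
  then show ?thesis by (simp add: S_def h_def)
qed

lemma predictor_block_inequality:
  assumes "convex_on (X i) (\<theta> i)" and "predictor \<theta> X A b \<beta> \<xi> w" and "y \<in> X i"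
  shows "\<theta> i (fst w $ i) \<le> \<theta> i y
           + (A i *v y - A i *v (fst w $ i)) \<bullet> (\<beta> *\<^sub>R (A i *v (fst w $ i) - xblock \<xi> i) - lblock \<xi>)"
proof (rule proximal_minimizer_variational_inequality[OF assms(1) _ _ assms(3)])
  show "linear ((*v) (A i))" by simp
  have "sub_objective \<theta> A b \<beta> \<xi> i = (\<lambda>y. \<theta> i y
      - lblock \<xi> \<bullet> (A i *v y + ((\<Sum>j\<in>UNIV - {i}. xblock \<xi> j) - b))
      + \<beta> / 2 * (norm (A i *v y - xblock \<xi> i))\<^sup>2)"
    by (simp add: fun_eq_iff sub_objective_def algebra_simps)
  then show "is_arg_min (\<lambda>y. \<theta> i y
      - lblock \<xi> \<bullet> (A i *v y + ((\<Sum>j\<in>UNIV - {i}. xblock \<xi> j) - b))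
      + \<beta> / 2 * (norm (A i *v y - xblock \<xi> i))\<^sup>2) (\<lambda>y. y \<in> X i) (fst w $ i)"
    using assms(2) unfolding predictor_def by metis
qed

text \<open>
  Moving \<open>A\<^sub>i\<^sup>T\<close> across the inner product expresses the variational inequality through the images
  \<open>A\<^sub>i x\<^sub>i\<close>, the only form in which the iteration sees the variables.
\<close>

lemma VI_map_inner:
  "(v - w) \<bullet> VI_map A b w' =
     (snd v - snd w) \<bullet> residual A b (fst w')
     - (\<Sum>i\<in>UNIV. (A i *v (fst v $ i) - A i *v (fst w $ i)) \<bullet> snd w')"
proof -
  have "(fst v $ i - fst w $ i) \<bullet> - (transpose (A i) *v snd w')
      = - ((A i *v (fst v $ i) - A i *v (fst w $ i)) \<bullet> snd w')" for i
    by (simp add: inner_commute[of _ "snd w' v* A i"] dot_lmul_matrix inner_commute[of _ "snd w'"]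
        matrix_vector_mult_diff_distrib)
  then show ?thesis
    by (simp add: VI_map_def inner_prod_def inner_vec_def[of "fst v - fst w"] sum_negf
        del: transpose_matrix_vector)
qed

text \<open>
  The optimality conditions of the subproblems are tested at \<open>z\<close>, and the variational inequality of
  \<open>z\<close> is tested at \<open>w\<close>. In the sum the objective values cancel, and so do the bilinear terms because
  the linear part of \<open>F\<close> is skew.
\<close>

lemma predictor_Fejer_inequality:
  assumes \<beta>: "\<beta> > 0" and conv: "\<And>i. convex_on (X i) (\<theta> i)"
    and w: "predictor \<theta> X A b \<beta> \<xi> w" and z: "z \<in> Omega_star \<theta> X A b"
  shows "0 \<le> (P_map A w - P_map A z) \<bullet> (Q_mat \<beta> *v (\<xi> - P_map A w))"
proof -
  define D where "D i = A i *v (fst w $ i) - A i *v (fst z $ i)" for i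
  have wX: "fst w $ i \<in> X i" and zX: "fst z $ i \<in> X i" for i
    using w z by (auto simp: predictor_def is_arg_min_def Omega_star_def Omega_def)
  have sw: "snd w = lblock \<xi> - \<beta> *\<^sub>R ((\<Sum>i\<in>UNIV. xblock \<xi> i) - b)"
    using w by (simp add: predictor_def)
  \<comment> \<open>The multiplier update uses the residual of \<open>\<xi>\<close>; the entries \<open>-I\<close> of \<open>Q\<close> shift it to the prediction.\<close>
  have res: "lblock (Q_mat \<beta> *v (\<xi> - P_map A w)) = residual A b (fst w)"
    using \<beta> by (simp add: Q_mat_blocks block_diff P_map_blocks sw sum_subtractf residual_def)
  have "(P_map A w - P_map A z) \<bullet> (Q_mat \<beta> *v (\<xi> - P_map A w)) =
      (\<Sum>i\<in>UNIV. D i \<bullet> (\<beta> *\<^sub>R (xblock \<xi> i - A i *v (fst w $ i)) + lblock \<xi>) - D i \<bullet> snd w)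
      + (snd w - snd z) \<bullet> residual A b (fst w)"
    unfolding inner_blocks res
    by (simp add: Q_mat_blocks block_diff P_map_blocks D_def inner_add_right inner_diff_right
        algebra_simps)
  also have "\<dots> \<ge> (\<Sum>i\<in>UNIV. (\<theta> i (fst w $ i) - \<theta> i (fst z $ i)) - D i \<bullet> snd w)
      + (snd w - snd z) \<bullet> residual A b (fst w)"
  proof (intro add_right_mono sum_mono diff_right_mono)
    fix i
    show "\<theta> i (fst w $ i) - \<theta> i (fst z $ i)
        \<le> D i \<bullet> (\<beta> *\<^sub>R (xblock \<xi> i - A i *v (fst w $ i)) + lblock \<xi>)"
      using predictor_block_inequality[OF conv w zX, of i]
      by (simp add: D_def inner_add_right inner_diff_right inner_diff_left algebra_simps)
  qed
  finally have low: "objective \<theta> (fst w) - objective \<theta> (fst z) - (\<Sum>i\<in>UNIV. D i \<bullet> snd w)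
      + (snd w - snd z) \<bullet> residual A b (fst w)
      \<le> (P_map A w - P_map A z) \<bullet> (Q_mat \<beta> *v (\<xi> - P_map A w))"
    by (simp add: sum_subtractf objective_def)
  have "w \<in> Omega X" using wX by (auto simp: Omega_def mem_Times_iff)
  then have opt: "0 \<le> objective \<theta> (fst w) - objective \<theta> (fst z)
      + ((snd w - snd z) \<bullet> residual A b (fst z) - (\<Sum>i\<in>UNIV. D i \<bullet> snd z))"
    using z by (auto simp: Omega_star_def D_def simp flip: VI_map_inner)
  have "residual A b (fst w) = residual A b (fst z) + sum D UNIV"
    by (simp add: residual_def D_def sum_subtractf)
  then have "(snd w - snd z) \<bullet> residual A b (fst w) - (snd w - snd z) \<bullet> residual A b (fst z)
      = (\<Sum>i\<in>UNIV. D i \<bullet> snd w) - (\<Sum>i\<in>UNIV. D i \<bullet> snd z)"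
    by (simp add: inner_add_right inner_diff_left inner_diff_right inner_commute[of _ "sum D UNIV"]
        flip: inner_sum_left)
  with low opt show ?thesis by linarith
qed

text \<open>
  When an iterate and its prediction approach the same point, the proximal terms and the multiplier
  increments vanish. The former leaves the block inequalities of the Lagrangian, the latter
  feasibility.
\<close>

lemma Xi_star_if_predictor_limit:
  fixes \<theta> :: "'p::finite \<Rightarrow> real^'n::finite \<Rightarrow> real" and A :: "'p \<Rightarrow> real^'n^'m::finite"
  assumes \<beta>: "\<beta> > 0"
    and epi: "\<And>i. closed (epigraph (coord_space (N i)) (\<theta> i))"
    and sub: "\<And>i. X i \<subseteq> coord_space (N i)" and clX: "\<And>i. closed (X i)"
    and conv: "\<And>i. convex_on (X i) (\<theta> i)"
    and A: "\<And>i. A i \<in> coord_mats (N i)" "\<And>i. full_column_rank (N i) (A i)"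
    and w: "\<And>k. predictor \<theta> X A b \<beta> (\<eta> k) (w k)"
    and lim: "\<eta> \<longlonglongrightarrow> \<zeta>" "(\<lambda>k. P_map A (w k)) \<longlonglongrightarrow> \<zeta>"
  shows "\<zeta> \<in> Xi_star \<theta> X A b"
proof -
  let ?l = "lblock \<zeta>"
  have wX: "fst (w k) $ i \<in> X i" for k i
    using w[of k] by (auto simp: predictor_def is_arg_min_def)
  have "\<exists>x. (\<lambda>k. fst (w k) $ i) \<longlonglongrightarrow> x" for i
  proof -
    obtain g where g: "linear g" "\<And>x. x \<in> coord_space (N i) \<Longrightarrow> g (A i *v x) = x"
      using full_column_rank_left_inverse A by metis
    have "(\<lambda>k. g (A i *v (fst (w k) $ i))) \<longlonglongrightarrow> g (xblock \<zeta> i)"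
      using tendsto_blocks(1)[OF lim(2), of i]
      by (intro bounded_linear.tendsto[OF linear_conv_bounded_linear[THEN iffD1, OF g(1)]])
        (simp add: P_map_blocks)
    moreover have "g (A i *v (fst (w k) $ i)) = fst (w k) $ i" for k
      using g(2) wX sub by blast
    ultimately show ?thesis by auto
  qed
  then obtain x where x: "\<And>i. (\<lambda>k. fst (w k) $ i) \<longlonglongrightarrow> x i" by metis
  have Ax: "(\<lambda>k. A i *v (fst (w k) $ i)) \<longlonglongrightarrow> A i *v x i" for i
    by (rule bounded_linear.tendsto[OF matrix_vector_mul_bounded_linear x])
  have Ax\<zeta>: "A i *v x i = xblock \<zeta> i" for i
    using LIMSEQ_unique[OF Ax] tendsto_blocks(1)[OF lim(2), of i] by (simp add: P_map_blocks)
  have xX: "x i \<in> X i" for i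
    by (rule closed_sequentially[OF clX wX x])
  have block: "\<theta> i (x i) \<le> \<theta> i y - (A i *v y - A i *v x i) \<bullet> ?l" if y: "y \<in> X i" for i y
  proof -
    \<comment> \<open>Closedness of the epigraph acts as lower semicontinuity: the upper bounds \<open>R k\<close> for its values converge, so the
      points \<open>(x\<^sub>i\<^sup>k, R k)\<close> of the epigraph do.\<close>
    define R where "R k = \<theta> i y + (A i *v y - A i *v (fst (w k) $ i)) \<bullet>
        (\<beta> *\<^sub>R (A i *v (fst (w k) $ i) - xblock (\<eta> k) i) - lblock (\<eta> k))" for k
    have "(fst (w k) $ i, R k) \<in> epigraph (coord_space (N i)) (\<theta> i)" for k
      using predictor_block_inequality[OF conv w y] subsetD[OF sub wX] by (auto simp: mem_epigraph R_def)
    moreover have "R \<longlonglongrightarrow> \<theta> i y + (A i *v y - A i *v x i) \<bullet> (\<beta> *\<^sub>R (A i *v x i - xblock \<zeta> i) - ?l)"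
      unfolding R_def by (intro tendsto_intros Ax tendsto_blocks lim)
    ultimately have "(x i, \<theta> i y + (A i *v y - A i *v x i) \<bullet> (\<beta> *\<^sub>R (A i *v x i - xblock \<zeta> i) - ?l))
        \<in> epigraph (coord_space (N i)) (\<theta> i)"
      using closed_sequentially[OF epi _ tendsto_Pair[OF x]] by blast
    then show ?thesis by (simp add: mem_epigraph Ax\<zeta>)
  qed
  define z where "z = ((\<chi> i. x i) :: real^'n^'p, ?l)"
  have "(\<lambda>k. lblock (\<eta> k) - \<beta> *\<^sub>R ((\<Sum>i\<in>UNIV. xblock (\<eta> k) i) - b)) \<longlonglongrightarrow>
      ?l - \<beta> *\<^sub>R ((\<Sum>i\<in>UNIV. xblock \<zeta> i) - b)"
    by (intro tendsto_intros tendsto_blocks lim)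
  moreover have "(\<lambda>k. snd (w k)) \<longlonglongrightarrow> ?l"
    using tendsto_blocks(2)[OF lim(2)] by (simp add: P_map_blocks)
  moreover have "snd (w k) = lblock (\<eta> k) - \<beta> *\<^sub>R ((\<Sum>i\<in>UNIV. xblock (\<eta> k) i) - b)" for k
    using w[of k] by (simp add: predictor_def)
  ultimately have "?l - \<beta> *\<^sub>R ((\<Sum>i\<in>UNIV. xblock \<zeta> i) - b) = ?l"
    by (simp only: LIMSEQ_unique)
  then have res: "residual A b (fst z) = 0"
    using \<beta> by (simp add: residual_def z_def Ax\<zeta>)
  have "0 \<le> objective \<theta> (fst v) - objective \<theta> (fst z) + (v - z) \<bullet> VI_map A b z"
    if v: "v \<in> Omega X" for v
  proof -
    have "0 \<le> (\<Sum>i\<in>UNIV. \<theta> i (fst v $ i) - \<theta> i (x i) - (A i *v (fst v $ i) - A i *v x i) \<bullet> ?l)"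
    proof (rule sum_nonneg)
      fix i
      have "fst v $ i \<in> X i" using v by (auto simp: Omega_def)
      from block[OF this]
      show "0 \<le> \<theta> i (fst v $ i) - \<theta> i (x i) - (A i *v (fst v $ i) - A i *v x i) \<bullet> ?l" by simp
    qed
    then show ?thesis
      unfolding VI_map_inner res by (simp add: objective_def z_def sum_subtractf)
  qed
  then have "z \<in> Omega_star \<theta> X A b"
    using xX by (auto simp: Omega_star_def Omega_def z_def)
  moreover have "P_map A z = \<zeta>"
    by (rule vec_eq_blocksI) (simp_all add: P_map_blocks z_def Ax\<zeta>)
  ultimately show ?thesis unfolding Xi_star_def by blast
qed

section \<open>Convergence of the method\<close>

theorem theorem4p2:
  fixes N :: "'p::finite \<Rightarrow> 'n::finite set"
    and \<theta> :: "'p \<Rightarrow> real^'n \<Rightarrow> real"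
    and X :: "'p \<Rightarrow> (real^'n) set"
    and A :: "'p \<Rightarrow> real^'n^'m::finite"
    and b :: "real^'m"
    and \<alpha> \<beta> :: real
    and \<xi> :: "nat \<Rightarrow> real^('p option \<times> 'm)"
  assumes "CARD('p) \<ge> 2"
    and "\<And>i. closed_convex_fun (coord_space (N i)) (\<theta> i)"
    and "\<And>i. X i \<subseteq> coord_space (N i)"
    and "\<And>i. closed (X i)"
    and "\<And>i. convex (X i)"
    and "\<And>i. A i \<in> coord_mats (N i)"
    and "\<And>i. full_column_rank (N i) (A i)"
    and "solution_set \<theta> X A b \<noteq> {}"
    and "Omega_star \<theta> X A b \<noteq> {}"
    and "\<beta> > 0"
    and "0 < \<alpha>" and "\<alpha> < 2"
    and "generated_sequence \<theta> X A b \<beta> \<alpha> \<xi>"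
  shows "\<exists>\<zeta> \<in> Xi_star \<theta> X A b. \<xi> \<longlonglongrightarrow> \<zeta>"
proof -
  have conv: "convex_on (X i) (\<theta> i)" for i
    using assms(2)[of i] assms(3,5) convex_on_subset unfolding closed_convex_fun_def by blast
  have epi: "closed (epigraph (coord_space (N i)) (\<theta> i))" for i
    using assms(2)[of i] by (simp add: closed_convex_fun_def)
  obtain w where w: "\<And>k. predictor \<theta> X A b \<beta> (\<xi> k) (w k)"
    and step: "\<And>k. \<xi> (Suc k) = \<xi> k - \<alpha> *\<^sub>R (M_mat \<beta> *v (\<xi> k - P_map A (w k)))"
    using assms(13) unfolding generated_sequence_def by metis
  show ?thesis
  proof (rule prediction_correction_converges[where D = "D_mat \<beta>" and Q = "Q_mat \<beta>"
        and \<xi>' = "\<lambda>k. P_map A (w k)"])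
    show "transpose (D_mat \<beta>) = D_mat \<beta>" by (rule transpose_D_mat)
    show "0 < \<alpha>" "\<alpha> < 2" by fact+
    show "Xi_star \<theta> X A b \<noteq> {}" using assms(9) by (simp add: Xi_star_def)
  next
    fix x :: "real^('p option \<times> 'm)" assume "x \<noteq> 0"
    then show "0 < x \<bullet> (D_mat \<beta> *v x)" using assms(10) by (intro D_mat_positive_definite)
  next
    fix x :: "real^('p option \<times> 'm)"
    show "x \<bullet> (Q_mat \<beta> *v x) = x \<bullet> (D_mat \<beta> *v x)" by (rule Q_mat_quadratic_form)
  next
    fix k
    show "\<xi> (Suc k) = \<xi> k - \<alpha> *\<^sub>R ((matrix_inv (transpose (Q_mat \<beta>)) ** D_mat \<beta>) *v
        (\<xi> k - P_map A (w k)))"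
      using step by (simp add: M_mat_def)
  next
    fix k z assume "z \<in> Xi_star \<theta> X A b"
    then show "0 \<le> (P_map A (w k) - z) \<bullet> (Q_mat \<beta> *v (\<xi> k - P_map A (w k)))"
      using predictor_Fejer_inequality[OF assms(10) conv w] by (auto simp: Xi_star_def)
  next
    fix r :: "nat \<Rightarrow> nat" and \<zeta>
    assume "(\<xi> \<circ> r) \<longlonglongrightarrow> \<zeta>" and "((\<lambda>k. P_map A (w k)) \<circ> r) \<longlonglongrightarrow> \<zeta>"
    then show "\<zeta> \<in> Xi_star \<theta> X A b"
      by (intro Xi_star_if_predictor_limit[where \<eta> = "\<xi> \<circ> r" and w = "w \<circ> r",
            OF assms(10) epi assms(3,4) conv assms(6,7)])
        (auto simp: w o_def)
  qed
qed

end
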